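(* Let $G$ be a directed graph on vertices $\{1,\dots,N\}$ with weights $w_{ij}\in\mathbb{R}\cup\{\infty\}$, where $w_{ii}=0$ and $w_{ij}=\infty$ if and only if there is no edge from $i$ to $j$ ($i\neq j$). Define matrices $D^k=(d^k_{ij})$ and sets $in^k_v, out^k_v\subseteq\{1,\dots,N\}$ for $k=0,1,\dots,N$ by: - $d^0_{ij}=w_{ij}$, $in^0_j=\{i: i\neq j,\ w_{ij}\neq\infty\}$, $out^0_i=\{j: j\neq i,\ w_{ij}\neq\infty\}$; - for $k\ge 1$: $d^k_{ij}=\min(d^{k-1}_{ij},\ d^{k-1}_{ik}+d^{k-1}_{kj})$ if $i\in in^{k-1}_k$ and $j\in out^{k-1}_k$, and $d^k_{ij}=d^{k-1}_{ij}$ otherwise; - for $k\ge1$: $in^k_j=in^{k-1}_j\cup\{i: d^{k-1}_{ij}=\infty,\ d^k_{ij}\neq\infty\}$ and $out^k_i=out^{k-1}_i\cup\{j: d^{k-1}_{ij}=\infty,\ d^k_{ij}\neq\infty\}$. In this recurrence, for each $k\ge1$ a relaxation attempt on the pair $(i,j)$ (i.e., evaluation of the comparison of $d^{k-1}_{ik}+d^{k-1}_{kj}$ with $d^{k-1}_{ij}$) is made exactly when $i\in in^{k-1}_k$ and $j\in out^{k-1}_k$. Then no useless relaxation attempt occurs: for every $k\ge1$ and every such pair $(i,j)$, both $d^{k-1}_{ik}$ and $d^{k-1}_{kj}$ are finite (not $\infty$).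
   Context: A relaxation attempt for the triple $(i,k,j)$ is the operation "if $d_{ik}+d_{kj}<d_{ij}$ then $d_{ij}\leftarrow d_{ik}+d_{kj}$". It is called useless if $d_{ik}=\infty$ or $d_{kj}=\infty$. The sets $in^\beta_\alpha$ (resp. $out^\beta_\alpha$) are intended as the lists of vertices at the other end of the incoming (resp. outgoing) finite entries of vertex $\alpha$ in the matrix $D^\beta$. *)

theory Defs
  imports "HOL-Library.Extended_Real"
begin

text \<open>
  Weights live in the reals extended by \<open>\<infinity>\<close>. They are represented in \<^typ>\<open>ereal\<close>; the value
  \<open>-\<infinity>\<close> has to be excluded by an assumption on the weight function.
  \<open>dmat\<close>, \<open>ins\<close> and \<open>outs\<close> are \<open>D\<^sup>k\<close>, \<open>in\<^sup>k\<close> and \<open>out\<^sup>k\<close>; only the stages \<open>k \<le> N\<close> and the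
  indices in \<open>{1..N}\<close> are meaningful.
\<close>

function (sequential)
  dmat :: "nat \<Rightarrow> (nat \<Rightarrow> nat \<Rightarrow> ereal) \<Rightarrow> nat \<Rightarrow> nat \<Rightarrow> nat \<Rightarrow> ereal" and
  ins :: "nat \<Rightarrow> (nat \<Rightarrow> nat \<Rightarrow> ereal) \<Rightarrow> nat \<Rightarrow> nat \<Rightarrow> nat set" and
  outs :: "nat \<Rightarrow> (nat \<Rightarrow> nat \<Rightarrow> ereal) \<Rightarrow> nat \<Rightarrow> nat \<Rightarrow> nat set"
where
  "dmat N w 0 i j = w i j"
| "dmat N w (Suc k) i j =
     (if i \<in> ins N w k (Suc k) \<and> j \<in> outs N w k (Suc k)
      then min (dmat N w k i j) (dmat N w k i (Suc k) + dmat N w k (Suc k) j)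
      else dmat N w k i j)"
| "ins N w 0 j = {i \<in> {1..N}. i \<noteq> j \<and> w i j \<noteq> \<infinity>}"
| "ins N w (Suc k) j =
     ins N w k j \<union> {i \<in> {1..N}. dmat N w k i j = \<infinity> \<and> dmat N w (Suc k) i j \<noteq> \<infinity>}"
| "outs N w 0 i = {j \<in> {1..N}. j \<noteq> i \<and> w i j \<noteq> \<infinity>}"
| "outs N w (Suc k) i =
     outs N w k i \<union> {j \<in> {1..N}. dmat N w k i j = \<infinity> \<and> dmat N w (Suc k) i j \<noteq> \<infinity>}"
  by pat_completeness auto
termination
  by (relation "measure (\<lambda>x. case x of
        Inl (N, w, k, i, j) \<Rightarrow> 2 * k
      | Inr (Inl (N, w, k, j)) \<Rightarrow> 2 * k + 1
      | Inr (Inr (N, w, k, i)) \<Rightarrow> 2 * k + 1)") auto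

text \<open>The pairs \<open>(i, j)\<close> for which stage \<open>k \<ge> 1\<close> makes a relaxation attempt.\<close>

definition attempts :: "nat \<Rightarrow> (nat \<Rightarrow> nat \<Rightarrow> ereal) \<Rightarrow> nat \<Rightarrow> (nat \<times> nat) set" where
  "attempts N w k = {(i, j). i \<in> ins N w (k - 1) k \<and> j \<in> outs N w (k - 1) k}"

definition useless :: "(nat \<Rightarrow> nat \<Rightarrow> ereal) \<Rightarrow> nat \<Rightarrow> nat \<Rightarrow> nat \<Rightarrow> bool" where
  "useless d i k j \<longleftrightarrow> d i k = \<infinity> \<or> d k j = \<infinity>"

end

theory Submission
  imports Defs
begin

text \<open>
  Entries of \<open>D\<^sup>k\<close> only decrease with \<open>k\<close>, so an entry that was finite when its index joined an
  in- or out-list stays below \<open>\<infinity>\<close>; and no stage creates the value \<open>-\<infinity>\<close>.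
\<close>

lemma dmat_Suc_le: "dmat N w (Suc k) i j \<le> dmat N w k i j"
  by simp

lemma dmat_Suc_neq_PInf: "dmat N w (Suc k) i j \<noteq> \<infinity>" if "dmat N w k i j \<noteq> \<infinity>"
  using that dmat_Suc_le[of N w k i j] by (metis ereal_infty_less_eq(1))

lemma ins_subset_neq_PInf: "ins N w k j \<subseteq> {i \<in> {1..N}. dmat N w k i j \<noteq> \<infinity>}"
proof (induction k)
  case 0
  show ?case by auto
next
  case (Suc k)
  then show ?case
    unfolding ins.simps using dmat_Suc_neq_PInf by blast
qed

lemma outs_subset_neq_PInf: "outs N w k i \<subseteq> {j \<in> {1..N}. dmat N w k i j \<noteq> \<infinity>}"
proof (induction k)
  case 0
  show ?case by auto
next
  case (Suc k)
  then show ?case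
    unfolding outs.simps using dmat_Suc_neq_PInf by blast
qed

lemma attempts_subset: "attempts N w k \<subseteq> {1..N} \<times> {1..N}"
  unfolding attempts_def using ins_subset_neq_PInf outs_subset_neq_PInf by blast

lemma attempts_imp_not_useless:
  assumes "(i, j) \<in> attempts N w k"
  shows "\<not> useless (dmat N w (k - 1)) i k j"
  using assms ins_subset_neq_PInf outs_subset_neq_PInf unfolding attempts_def useless_def by blast

lemma dmat_neq_MInf:
  assumes w_neq_MInf: "\<forall>i\<in>V. \<forall>j\<in>V. w i j \<noteq> -\<infinity>"
    and "{1..k} \<subseteq> V" "i \<in> V" "j \<in> V"
  shows "dmat N w k i j \<noteq> -\<infinity>"
  using assms(2-)
proof (induction k arbitrary: i j)
  case 0
  with w_neq_MInf show ?case by simp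
next
  case (Suc k)
  then have "{1..k} \<subseteq> V" "Suc k \<in> V" by auto
  with Suc have "dmat N w k i j \<noteq> -\<infinity>" "dmat N w k i (Suc k) \<noteq> -\<infinity>" "dmat N w k (Suc k) j \<noteq> -\<infinity>"
    by blast+
  then show ?case
    by (simp add: min_def)
qed

lemma attempts_imp_finite:
  assumes w_neq_MInf: "\<forall>i\<in>{1..N}. \<forall>j\<in>{1..N}. w i j \<noteq> -\<infinity>"
    and "k \<in> {1..N}" and attempt: "(i, j) \<in> attempts N w k"
  shows "\<bar>dmat N w (k - 1) i k\<bar> \<noteq> \<infinity>" and "\<bar>dmat N w (k - 1) k j\<bar> \<noteq> \<infinity>"
proof -
  have "i \<in> {1..N}" "j \<in> {1..N}"
    using attempt attempts_subset by blast+
  moreover have "{1..k - 1} \<subseteq> {1..N}"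
    using \<open>k \<in> {1..N}\<close> by auto
  ultimately have "dmat N w (k - 1) i k \<noteq> -\<infinity>" "dmat N w (k - 1) k j \<noteq> -\<infinity>"
    using dmat_neq_MInf[OF w_neq_MInf] \<open>k \<in> {1..N}\<close> by blast+
  moreover have "dmat N w (k - 1) i k \<noteq> \<infinity>" "dmat N w (k - 1) k j \<noteq> \<infinity>"
    using attempts_imp_not_useless[OF attempt] by (simp_all add: useless_def)
  ultimately show "\<bar>dmat N w (k - 1) i k\<bar> \<noteq> \<infinity>" and "\<bar>dmat N w (k - 1) k j\<bar> \<noteq> \<infinity>"
    using abs_eq_infinity_cases by metis+
qed

theorem theorem1:
  fixes N :: nat and E :: "(nat \<times> nat) set" and w :: "nat \<Rightarrow> nat \<Rightarrow> ereal"
  assumes "E \<subseteq> {1..N} \<times> {1..N}"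
    and "\<And>i j. i \<in> {1..N} \<Longrightarrow> j \<in> {1..N} \<Longrightarrow> w i j \<noteq> -\<infinity>"
    and "\<And>i. i \<in> {1..N} \<Longrightarrow> w i i = 0"
    and "\<And>i j. i \<in> {1..N} \<Longrightarrow> j \<in> {1..N} \<Longrightarrow> i \<noteq> j \<Longrightarrow> w i j = \<infinity> \<longleftrightarrow> (i, j) \<notin> E"
  shows "\<forall>k\<in>{1..N}. \<forall>(i, j)\<in>attempts N w k.
           \<not> useless (dmat N w (k - 1)) i k j \<and>
           \<bar>dmat N w (k - 1) i k\<bar> \<noteq> \<infinity> \<and> \<bar>dmat N w (k - 1) k j\<bar> \<noteq> \<infinity>"
proof -
  have w_neq_MInf: "\<forall>i\<in>{1..N}. \<forall>j\<in>{1..N}. w i j \<noteq> -\<infinity>"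
    using assms(2) by blast
  show ?thesis
    using attempts_imp_not_useless attempts_imp_finite[OF w_neq_MInf]
    by (intro ballI case_prodI2) simp
qed

end
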